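(* Let $G$ be a connected graph, let $k\geq 1$ be an integer, and let $D^{k}\subseteq V(G)$ be a connected $k$-step dominating set of $G$. Then $G$ has a connected $(k-1)$-step dominating set $D^{k-1}\supseteq D^{k}$ such that $$rc(G[D^{k-1}])\leq rc(G[D^{k}])+\max\{2k+1,b_k\},$$ where $b_k$ is the number of bridges of $G$ lying in $E(D^{k},N(D^{k}))$.
   Context: All graphs are simple, finite and undirected. For an edge-coloring of a graph $H$ (adjacent edges may receive the same color), $H$ is rainbow connected if every pair of distinct vertices is joined by a path whose edges have pairwise distinct colors; the rainbow connection number $rc(H)$ is the minimum number of colors in an edge-coloring making $H$ rainbow connected (so $rc(H)=0$ if $H$ has a single vertex). $G[S]$ denotes the subgraph induced by $S$. For $S\subseteq V(G)$, $N^{j}(S)=\{v\in V(G): d_G(v,S)=j\}$ and $N(S)=N^{1}(S)$. $S$ is a $k$-step dominating set if every vertex of $G$ is at distance at most $k$ from $S$; it is a connected $k$-step dominating set if moreover $G[S]$ is connected (a connected $0$-step dominating set is thus $V(G)$). For $X,Y\subseteq V(G)$, $E(X,Y)$ is the set of edges with one end in $X$ and the other in $Y$. A bridge of $G$ is an edge whose deletion disconnects $G$. *)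

theory Defs
  imports Main "HOL-Library.Extended_Nat"
begin

section \<open>Finite simple undirected graphs\<close>

record 'a ugraph =
  verts :: "'a set"
  edges :: "'a set set"

definition simple_graph :: "'a ugraph \<Rightarrow> bool" where
  "simple_graph G \<longleftrightarrow> finite (verts G) \<and> (\<forall>e\<in>edges G. e \<subseteq> verts G \<and> card e = 2)"

definition induced :: "'a ugraph \<Rightarrow> 'a set \<Rightarrow> 'a ugraph" where
  "induced G S = \<lparr>verts = S, edges = {e \<in> edges G. e \<subseteq> S}\<rparr>"

definition delete_edge :: "'a ugraph \<Rightarrow> 'a set \<Rightarrow> 'a ugraph" where
  "delete_edge G e = \<lparr>verts = verts G, edges = edges G - {e}\<rparr>"

text \<open>A path is given by its list of vertices, so that a path on \<open>n + 1\<close> vertices has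
  length \<open>n\<close>; a single vertex is a path of length 0.\<close>

definition path_from_to :: "'a ugraph \<Rightarrow> 'a \<Rightarrow> 'a list \<Rightarrow> 'a \<Rightarrow> bool" where
  "path_from_to G u p v \<longleftrightarrow>
     p \<noteq> [] \<and> hd p = u \<and> last p = v \<and> distinct p \<and> set p \<subseteq> verts G \<and>
     successively (\<lambda>x y. {x, y} \<in> edges G) p"

definition path_edges :: "'a list \<Rightarrow> 'a set list" where
  "path_edges p = map2 (\<lambda>x y. {x, y}) p (tl p)"

definition graph_connected :: "'a ugraph \<Rightarrow> bool" where
  "graph_connected G \<longleftrightarrow>
     verts G \<noteq> {} \<and> (\<forall>u\<in>verts G. \<forall>v\<in>verts G. \<exists>p. path_from_to G u p v)"

definition is_bridge :: "'a ugraph \<Rightarrow> 'a set \<Rightarrow> bool" where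
  "is_bridge G e \<longleftrightarrow>
     e \<in> edges G \<and> graph_connected G \<and> \<not> graph_connected (delete_edge G e)"

definition edges_between :: "'a ugraph \<Rightarrow> 'a set \<Rightarrow> 'a set \<Rightarrow> 'a set set" where
  "edges_between G X Y = {e \<in> edges G. \<exists>x\<in>X. \<exists>y\<in>Y. e = {x, y}}"

section \<open>Distance and step domination\<close>

text \<open>An infimum over the empty set is \<open>\<infinity>\<close>: this is the distance between vertices not joined
  by a path, and the distance to the empty set.\<close>

definition graph_dist :: "'a ugraph \<Rightarrow> 'a \<Rightarrow> 'a \<Rightarrow> enat" where
  "graph_dist G u v = (INF p\<in>{p. path_from_to G u p v}. enat (length (path_edges p)))"

definition dist_to_set :: "'a ugraph \<Rightarrow> 'a \<Rightarrow> 'a set \<Rightarrow> enat" where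
  "dist_to_set G v S = (INF s\<in>S. graph_dist G v s)"

definition step_nbhd :: "'a ugraph \<Rightarrow> nat \<Rightarrow> 'a set \<Rightarrow> 'a set" where
  "step_nbhd G j S = {v \<in> verts G. dist_to_set G v S = enat j}"

abbreviation nbhd :: "'a ugraph \<Rightarrow> 'a set \<Rightarrow> 'a set" where
  "nbhd G S \<equiv> step_nbhd G 1 S"

definition step_dominating :: "'a ugraph \<Rightarrow> nat \<Rightarrow> 'a set \<Rightarrow> bool" where
  "step_dominating G k S \<longleftrightarrow>
     S \<subseteq> verts G \<and> (\<forall>v\<in>verts G. dist_to_set G v S \<le> enat k)"

definition connected_step_dominating :: "'a ugraph \<Rightarrow> nat \<Rightarrow> 'a set \<Rightarrow> bool" where
  "connected_step_dominating G k S \<longleftrightarrow>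
     step_dominating G k S \<and> graph_connected (induced G S)"

section \<open>Rainbow connection\<close>

text \<open>Colors are natural numbers. Colorings are total functions, of which only the values on
  the edges matter.\<close>

definition rainbow_connected :: "'a ugraph \<Rightarrow> ('a set \<Rightarrow> nat) \<Rightarrow> bool" where
  "rainbow_connected G c \<longleftrightarrow>
     (\<forall>u\<in>verts G. \<forall>v\<in>verts G. u \<noteq> v \<longrightarrow>
        (\<exists>p. path_from_to G u p v \<and> distinct (map c (path_edges p))))"

text \<open>Meaningful for connected graphs only: other graphs have no rainbow connecting coloring, and
  the minimum is then unspecified.\<close>

definition rc :: "'a ugraph \<Rightarrow> nat" where
  "rc G = (LEAST n. \<exists>c. rainbow_connected G c \<and> card (c ` edges G) = n)"

end

theory Submission
  imports Defs
begin

text \<open>Take a breadth-first forest rooted in \<open>D\<close>; its branches are indexed by the vertices of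
  \<open>N(D)\<close>. Call two branches adjacent if some edge joins them, and give each branch one of two
  labels so that every non-isolated branch has a neighbor with the other label. An edge whose ends
  have depths \<open>i < j\<close> gets the color (label of the branch of its lower end, \<open>j\<close>), and an edge
  joining vertices of equal positive depth gets one further color: at most \<open>2k + 1\<close> new colors.
  A vertex \<open>v\<close> of depth \<open>i\<close> in a branch with label \<open>b\<close> descends to \<open>D\<close> using only colors
  \<open>(b, m)\<close> with \<open>m \<le> i\<close>. If \<open>v\<close> is an ancestor of an end of an edge joining branches with
  different labels, it also reaches \<open>D\<close> by ascending to that edge and descending on its other side,
  which avoids all these colors. The same holds for a root with a second neighbor in \<open>D\<close>, since
  the non-forest edges between \<open>D\<close> and \<open>N(D)\<close> get the opposite label. Let \<open>D'\<close>
  consist of \<open>D\<close>, \<open>N(D)\<close> and all such ancestors. A root in \<open>N(D)\<close> having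
  neither such an ascent nor a second neighbor in \<open>D\<close> hangs on a bridge; these bridges get
  pairwise distinct colors, which may be reused from the \<open>2k + 1\<close> ones, because every other
  vertex has two escapes with disjoint color sets.\<close>

section \<open>Paths and distances\<close>

lemma path_edges_Nil [simp]: "path_edges [] = []"
  and path_edges_single [simp]: "path_edges [x] = []"
  and path_edges_Cons_Cons [simp]: "path_edges (x # y # ps) = {x, y} # path_edges (y # ps)"
  by (simp_all add: path_edges_def)

lemma length_path_edges: "length (path_edges p) = length p - 1"
  by (simp add: path_edges_def)

lemma path_edges_subset: "e \<in> set (path_edges p) \<Longrightarrow> e \<subseteq> set p"
  by (induction p rule: induct_list012) auto

lemma distinct_path_edges: "distinct p \<Longrightarrow> distinct (path_edges p)"
proof (induction p rule: induct_list012)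
  case (3 x y ps)
  then show ?case using path_edges_subset[of "{x, y}" "y # ps"] by auto
qed simp_all

lemma path_edges_append: "\<exists>es. path_edges (xs @ u # ys) = es @ path_edges (u # ys)"
proof (induction xs)
  case (Cons x xs)
  then obtain es where es: "path_edges (xs @ u # ys) = es @ path_edges (u # ys)" by blast
  show ?case
  proof (cases xs)
    case Nil
    then show ?thesis by (auto intro: exI[of _ "[{x, u}]"])
  next
    case (Cons z zs)
    then show ?thesis using es by (auto intro: exI[of _ "{x, z} # es"])
  qed
qed simp

lemma path_edges_in_edges:
  "path_from_to G u p v \<Longrightarrow> e \<in> set (path_edges p) \<Longrightarrow> e \<in> edges G"
proof (induction p arbitrary: u rule: induct_list012)
  case (3 x y ps)
  then have "path_from_to G y (y # ps) v" by (auto simp: path_from_to_def)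
  with 3 show ?case by (auto simp: path_from_to_def)
qed simp_all

lemma path_single: "u \<in> verts G \<Longrightarrow> path_from_to G u [u] u"
  by (simp add: path_from_to_def)

lemma path_Cons:
  "path_from_to G v p t \<Longrightarrow> {u, v} \<in> edges G \<Longrightarrow> u \<in> verts G \<Longrightarrow> u \<notin> set p \<Longrightarrow>
    path_from_to G u (u # p) t"
  by (cases p) (auto simp: path_from_to_def)

lemma path_suffix:
  "path_from_to G v (xs @ u # ys) t \<Longrightarrow> path_from_to G u (u # ys) t"
  by (auto simp: path_from_to_def successively_append_iff)

lemma path_stays:
  assumes "path_from_to G u p v" and "u \<in> T"
    and "\<And>x y. {x, y} \<in> edges G \<Longrightarrow> x \<in> T \<Longrightarrow> y \<in> T"
  shows "v \<in> T"
  using assms(1,2)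
proof (induction p arbitrary: u rule: induct_list012)
  case (3 x y ps)
  then have "path_from_to G y (y # ps) v" "{x, y} \<in> edges G" "x = u"
    by (auto simp: path_from_to_def)
  with 3 assms(3) show ?case by blast
qed (auto simp: path_from_to_def)

text \<open>For a finite bound the infimum is attained: \<open>\<le> n\<close> is the same as
  \<open>< Suc n\<close>, and strict upper bounds on an infimum have witnesses.\<close>

lemma enat_INF_le_iff:
  fixes f :: "'b \<Rightarrow> enat"
  shows "(INF x\<in>A. f x) \<le> enat n \<longleftrightarrow> (\<exists>x\<in>A. f x \<le> enat n)"
proof
  assume "(INF x\<in>A. f x) \<le> enat n"
  then have "(INF x\<in>A. f x) < enat (Suc n)"
    by (metis enat_ord_simps(2) lessI order_le_less_trans)
  then obtain x where "x \<in> A" "f x < enat (Suc n)" by (auto simp: INF_less_iff)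
  then show "\<exists>x\<in>A. f x \<le> enat n"
    by (intro bexI[of _ x]) (cases "f x"; simp)+
qed (meson INF_lower2)

text \<open>Paths are measured here by their number of vertices, hence \<open>Suc n\<close>. The
  distance lemmas below are proved through this form.\<close>

lemma dist_to_set_le_iff:
  "dist_to_set G v S \<le> enat n \<longleftrightarrow>
    (\<exists>s\<in>S. \<exists>p. path_from_to G v p s \<and> length p \<le> Suc n)"
  unfolding dist_to_set_def graph_dist_def enat_INF_le_iff
  by (simp add: length_path_edges le_diff_conv)

lemma dist_to_set_eq_0_iff:
  "v \<in> verts G \<Longrightarrow> dist_to_set G v S = 0 \<longleftrightarrow> v \<in> S"
proof
  assume "dist_to_set G v S = 0"
  then have "dist_to_set G v S \<le> enat 0" by (simp add: enat_0_iff)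
  then obtain s p where "s \<in> S" "path_from_to G v p s" "length p \<le> 1"
    unfolding dist_to_set_le_iff by auto
  then show "v \<in> S" by (cases p) (auto simp: path_from_to_def)
next
  assume "v \<in> verts G" "v \<in> S"
  then have "dist_to_set G v S \<le> enat 0"
    unfolding dist_to_set_le_iff using path_single by fastforce
  then show "dist_to_set G v S = 0" by (metis enat_0 le_zero_eq)
qed

text \<open>Prepend \<open>u\<close> to a path from \<open>v\<close>; if \<open>u\<close> already
  lies on that path, its part starting at \<open>u\<close> is short enough.\<close>

lemma dist_to_set_step:
  assumes "{u, v} \<in> edges G" "u \<in> verts G" "dist_to_set G v S \<le> enat n"
  shows "dist_to_set G u S \<le> enat (Suc n)"
proof -
  obtain s p where p: "s \<in> S" "path_from_to G v p s" "length p \<le> Suc n"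
    using assms(3) unfolding dist_to_set_le_iff by auto
  show ?thesis
  proof (cases "u \<in> set p")
    case True
    then obtain xs ys where "p = xs @ u # ys" by (meson split_list)
    with p have "path_from_to G u (u # ys) s" "length (u # ys) \<le> Suc (Suc n)"
      by (auto dest: path_suffix)
    then show ?thesis unfolding dist_to_set_le_iff using p(1) by blast
  next
    case False
    then have "path_from_to G u (u # p) s" using p assms path_Cons by metis
    then show ?thesis unfolding dist_to_set_le_iff using p by fastforce
  qed
qed

text \<open>The second vertex of a shortest path works: were it closer than \<open>n\<close>,
  \<open>dist_to_set_step\<close> would bring \<open>v\<close> too close.\<close>

lemma dist_to_set_pred:
  assumes "v \<in> verts G" "dist_to_set G v S = enat (Suc n)"
  obtains w where "{v, w} \<in> edges G" "w \<in> verts G" "dist_to_set G w S = enat n"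
proof -
  have "dist_to_set G v S \<le> enat (Suc n)" using assms by simp
  then obtain s p where p: "s \<in> S" "path_from_to G v p s" "length p \<le> Suc (Suc n)"
    unfolding dist_to_set_le_iff by auto
  have "v \<notin> S"
    using dist_to_set_eq_0_iff[OF assms(1), of S] assms(2) by (metis enat_0_iff(1) nat.distinct(1))
  then have "hd p = v" "p \<noteq> []" "last p \<noteq> v"
    using p(1,2) unfolding path_from_to_def by metis+
  then obtain w ps where p_eq: "p = v # w # ps"
    by (cases p; cases "tl p") auto
  have e: "{v, w} \<in> edges G" "w \<in> verts G" using p p_eq by (auto simp: path_from_to_def)
  have "path_from_to G w (w # ps) s" using p p_eq by (auto simp: path_from_to_def)
  then have le: "dist_to_set G w S \<le> enat n"
    unfolding dist_to_set_le_iff using p p_eq by fastforce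
  have "dist_to_set G w S = enat n"
  proof (rule ccontr)
    assume "dist_to_set G w S \<noteq> enat n"
    then obtain m where "dist_to_set G w S = enat m" "m < n"
      using le by (cases "dist_to_set G w S") auto
    then have "dist_to_set G v S \<le> enat (Suc m)"
      using dist_to_set_step[OF e(1) assms(1), of S m] by simp
    then show False using assms \<open>m < n\<close> by simp
  qed
  then show thesis using that e by blast
qed

section \<open>Rainbow walks\<close>

text \<open>The index is exactly the set of colors used, each once. Vertices may repeat, so
  concatenation only requires disjoint color sets.\<close>

inductive rainbow_walk :: "'a ugraph \<Rightarrow> ('a set \<Rightarrow> nat) \<Rightarrow> nat set \<Rightarrow> 'a \<Rightarrow> 'a \<Rightarrow> bool"
  for G c where
  refl: "u \<in> verts G \<Longrightarrow> rainbow_walk G c {} u u"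
| step: "{u, v} \<in> edges G \<Longrightarrow> u \<in> verts G \<Longrightarrow> c {u, v} \<notin> X \<Longrightarrow> rainbow_walk G c X v w \<Longrightarrow>
    rainbow_walk G c (insert (c {u, v}) X) u w"

lemma rainbow_walk_verts:
  "rainbow_walk G c X u v \<Longrightarrow> u \<in> verts G \<and> v \<in> verts G"
  by (induction rule: rainbow_walk.induct) auto

lemma rainbow_walk_edge:
  "{u, v} \<in> edges G \<Longrightarrow> u \<in> verts G \<Longrightarrow> v \<in> verts G \<Longrightarrow> rainbow_walk G c {c {u, v}} u v"
  by (metis empty_iff rainbow_walk.refl rainbow_walk.step)

lemma rainbow_walk_trans:
  "rainbow_walk G c X u v \<Longrightarrow> rainbow_walk G c Y v w \<Longrightarrow> X \<inter> Y = {} \<Longrightarrow>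
    rainbow_walk G c (X \<union> Y) u w"
  by (induction rule: rainbow_walk.induct) (auto intro: rainbow_walk.step)

lemma rainbow_walk_sym: "rainbow_walk G c X u v \<Longrightarrow> rainbow_walk G c X v u"
proof (induction rule: rainbow_walk.induct)
  case (step u v X w)
  have "rainbow_walk G c {c {u, v}} v u"
    using rainbow_walk_edge[of v u G c] step rainbow_walk_verts[OF step(4)]
    by (simp add: insert_commute)
  then show ?case using rainbow_walk_trans[OF step.IH] step by fastforce
qed (rule rainbow_walk.refl)

text \<open>If the new first vertex recurs on the path, cutting back to that occurrence only drops
  edges. The inclusion in \<open>X\<close> is carried along to keep the color of a prepended edge
  fresh.\<close>

lemma rainbow_walk_imp_path:
  "rainbow_walk G c X u v \<Longrightarrow>
    \<exists>p. path_from_to G u p v \<and> distinct (map c (path_edges p)) \<and> c ` set (path_edges p) \<subseteq> X"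
proof (induction rule: rainbow_walk.induct)
  case (refl u)
  then show ?case using path_single by fastforce
next
  case (step u v X w)
  then obtain p where p: "path_from_to G v p w" "distinct (map c (path_edges p))"
    "c ` set (path_edges p) \<subseteq> X" by blast
  show ?case
  proof (cases "u \<in> set p")
    case True
    then obtain xs ys where xs: "p = xs @ u # ys" by (meson split_list)
    obtain es where "path_edges p = es @ path_edges (u # ys)" using path_edges_append xs by metis
    with p xs show ?thesis by (intro exI[of _ "u # ys"]) (auto dest: path_suffix)
  next
    case False
    then have path: "path_from_to G u (u # p) w" using path_Cons p step by metis
    obtain ps where "p = v # ps" using p(1) by (cases p) (auto simp: path_from_to_def)
    with p step.hyps path show ?thesis by (intro exI[of _ "u # p"]) auto
  qed
qed

lemma path_imp_rainbow_walk:
  "path_from_to G u p v \<Longrightarrow> distinct (map c (path_edges p)) \<Longrightarrow>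
    rainbow_walk G c (c ` set (path_edges p)) u v"
proof (induction p arbitrary: u rule: induct_list012)
  case (2 x)
  then show ?case by (auto simp: path_from_to_def intro: rainbow_walk.refl)
next
  case (3 x y ps)
  then have "path_from_to G y (y # ps) v" "{x, y} \<in> edges G" "x = u" "x \<in> verts G"
    by (auto simp: path_from_to_def)
  with 3 show ?case by (auto intro: rainbow_walk.step)
qed (simp add: path_from_to_def)

lemma rainbow_walk_mono:
  assumes "rainbow_walk G c X u v" "verts G \<subseteq> verts H" "edges G \<subseteq> edges H"
    "\<And>e. e \<in> edges G \<Longrightarrow> c' e = c e"
  shows "rainbow_walk H c' X u v"
  using assms(1)
proof (induction rule: rainbow_walk.induct)
  case (refl u)
  then show ?case using assms by (auto intro: rainbow_walk.refl)
next
  case (step u v X w)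
  then show ?case using rainbow_walk.step[of u v H c' X w] assms by auto
qed

lemma rainbow_connectedI:
  assumes "\<And>u v. u \<in> verts G \<Longrightarrow> v \<in> verts G \<Longrightarrow> \<exists>X. rainbow_walk G c X u v"
  shows "rainbow_connected G c"
  unfolding rainbow_connected_def using assms rainbow_walk_imp_path by metis

lemma rainbow_connected_walk:
  assumes "rainbow_connected G c" "u \<in> verts G" "v \<in> verts G"
  obtains X where "rainbow_walk G c X u v" "X \<subseteq> c ` edges G"
proof (cases "u = v")
  case True
  then show thesis using that rainbow_walk.refl assms by fastforce
next
  case False
  then obtain p where p: "path_from_to G u p v" "distinct (map c (path_edges p))"
    using assms unfolding rainbow_connected_def by blast
  show thesis
    using that[OF path_imp_rainbow_walk[OF p]] path_edges_in_edges[OF p(1)] by blast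
qed

lemma rainbow_connected_imp_connected:
  "rainbow_connected G c \<Longrightarrow> verts G \<noteq> {} \<Longrightarrow> graph_connected G"
  unfolding graph_connected_def rainbow_connected_def by (metis path_single)

lemma rc_le: "rainbow_connected G c \<Longrightarrow> rc G \<le> card (c ` edges G)"
  unfolding rc_def by (rule Least_le) blast

text \<open>A path repeats no edge, so a coloring injective on the edges is rainbow; thus the
  \<open>LEAST\<close> in \<open>rc\<close> ranges over a nonempty set.\<close>

lemma rc_attained:
  assumes "graph_connected G" "finite (edges G)"
  obtains c where "rainbow_connected G c" "card (c ` edges G) = rc G"
proof -
  obtain c :: "'a set \<Rightarrow> nat" where c: "inj_on c (edges G)"
    using finite_imp_inj_to_nat_seg assms(2) by metis
  have "rainbow_connected G c"
    unfolding rainbow_connected_def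
  proof (intro ballI impI)
    fix u v assume "u \<in> verts G" "v \<in> verts G"
    then obtain p where p: "path_from_to G u p v"
      using assms unfolding graph_connected_def by blast
    then have "distinct (path_edges p)"
      using distinct_path_edges by (auto simp: path_from_to_def)
    moreover have "set (path_edges p) \<subseteq> edges G"
      using path_edges_in_edges[OF p] by blast
    ultimately have "distinct (map c (path_edges p))"
      using c by (auto simp: distinct_map intro: inj_on_subset)
    with p show "\<exists>p. path_from_to G u p v \<and> distinct (map c (path_edges p))" by blast
  qed
  then have "\<exists>n c. rainbow_connected G c \<and> card (c ` edges G) = n" by blast
  then have "\<exists>c. rainbow_connected G c \<and> card (c ` edges G) = rc G"
    unfolding rc_def by (rule LeastI_ex)
  then show thesis using that by blast
qed

text \<open>The set \<open>I\<close> is a maximal independent set.\<close>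

lemma exists_splitting_set:
  assumes "finite N" "\<And>r s. R r s \<Longrightarrow> R s r" "\<And>r. \<not> R r r" "\<And>r s. R r s \<Longrightarrow> r \<in> N"
  shows "\<exists>I. \<forall>r s. R r s \<longrightarrow> (\<exists>s'. R r s' \<and> (r \<in> I) \<noteq> (s' \<in> I))"
proof -
  define F where "F = {I. I \<subseteq> N \<and> (\<forall>r\<in>I. \<forall>s\<in>I. \<not> R r s)}"
  have "finite F" using assms(1) unfolding F_def by auto
  moreover have "{} \<in> F" unfolding F_def by simp
  ultimately obtain I where I: "I \<in> F" and max: "\<And>J. J \<in> F \<Longrightarrow> I \<subseteq> J \<Longrightarrow> J = I"
    using finite_has_maximal2[of F "{}"] by metis
  have "\<exists>s'. R r s' \<and> (r \<in> I) \<noteq> (s' \<in> I)" if "R r s" for r s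
  proof (cases "r \<in> I")
    case True
    then show ?thesis using that I unfolding F_def by blast
  next
    case False
    then have "insert r I \<notin> F" using max by blast
    moreover have "r \<in> N" "I \<subseteq> N" "\<forall>x\<in>I. \<forall>y\<in>I. \<not> R x y"
      using assms(4) that I unfolding F_def by auto
    ultimately obtain s' where "s' \<in> I" "R r s'"
      using assms(2,3) unfolding F_def by auto
    then show ?thesis using False by blast
  qed
  then show ?thesis by blast
qed

section \<open>The breadth-first forest of a step dominating set\<close>

locale step_domination =
  fixes G :: "'a ugraph" and D :: "'a set" and k :: nat
  assumes simple: "simple_graph G"
    and conn: "graph_connected G"
    and dom: "connected_step_dominating G k D"
begin

text \<open>On vertices of \<open>G\<close> the distance is finite by step domination, so
  \<open>the_enat\<close> loses nothing there.\<close>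

definition depth :: "'a \<Rightarrow> nat" where
  "depth v = the_enat (dist_to_set G v D)"

definition par :: "'a \<Rightarrow> 'a" where
  "par v = (SOME w. {v, w} \<in> edges G \<and> Suc (depth w) = depth v)"

text \<open>One parent step fewer than the depth: the iteration stops at the root in N(D) instead of
  entering \<open>D\<close>.\<close>

definition branch :: "'a \<Rightarrow> 'a" where
  "branch v = (par ^^ (depth v - 1)) v"

definition cross :: "'a \<Rightarrow> 'a \<Rightarrow> bool" where
  "cross r s \<longleftrightarrow> r \<noteq> s \<and>
    (\<exists>u w. {u, w} \<in> edges G \<and> 0 < depth u \<and> 0 < depth w \<and> branch u = r \<and> branch w = s)"

lemma D_subset: "D \<subseteq> verts G"
  using dom by (simp add: connected_step_dominating_def step_dominating_def)

lemma D_connected: "graph_connected (induced G D)"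
  using dom by (simp add: connected_step_dominating_def)

lemma D_nonempty: "D \<noteq> {}"
  using D_connected by (simp add: graph_connected_def induced_def)

lemma finite_verts: "finite (verts G)"
  using simple by (simp add: simple_graph_def)

lemma finite_edges: "finite (edges G)"
  by (rule finite_subset[of _ "Pow (verts G)"])
    (use simple in \<open>auto simp: simple_graph_def\<close>)

lemma edge_verts:
  assumes "{u, v} \<in> edges G"
  shows "u \<in> verts G" "v \<in> verts G" "u \<noteq> v"
  using assms simple by (auto simp: simple_graph_def)

lemma edge_cases:
  assumes "e \<in> edges G"
  obtains u v where "e = {u, v}" "depth u \<le> depth v"
proof -
  have "card e = 2" using assms simple by (simp add: simple_graph_def)
  then obtain u v where "e = {u, v}" by (meson card_2_iff)
  then show thesis using that[of u v] that[of v u] by (cases "depth u \<le> depth v") auto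
qed

lemma dist_eq_depth:
  assumes "v \<in> verts G"
  shows "dist_to_set G v D = enat (depth v)"
proof -
  have "dist_to_set G v D \<le> enat k"
    using dom assms by (simp add: connected_step_dominating_def step_dominating_def)
  then show ?thesis unfolding depth_def by (cases "dist_to_set G v D") auto
qed

lemma depth_le: "v \<in> verts G \<Longrightarrow> depth v \<le> k"
  using dom dist_eq_depth by (auto simp: connected_step_dominating_def step_dominating_def)

lemma depth_eq_0_iff: "v \<in> verts G \<Longrightarrow> depth v = 0 \<longleftrightarrow> v \<in> D"
  using dist_to_set_eq_0_iff[of v G D] dist_eq_depth by (metis enat_0_iff(1))

lemma depth_D: "v \<in> D \<Longrightarrow> depth v = 0"
  using depth_eq_0_iff D_subset by blast

lemma depth_edge:
  assumes "{u, v} \<in> edges G"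
  shows "depth u \<le> Suc (depth v)"
  using dist_to_set_step[OF assms, of D "depth v"] edge_verts[OF assms] dist_eq_depth by simp

lemma par:
  assumes "v \<in> verts G" "0 < depth v"
  shows "{v, par v} \<in> edges G" "Suc (depth (par v)) = depth v" "par v \<in> verts G"
proof -
  have "dist_to_set G v D = enat (Suc (depth v - 1))" using dist_eq_depth assms by simp
  then obtain w where w: "{v, w} \<in> edges G" "w \<in> verts G" "dist_to_set G w D = enat (depth v - 1)"
    using dist_to_set_pred assms(1) by metis
  then have "{v, w} \<in> edges G \<and> Suc (depth w) = depth v"
    using dist_eq_depth assms by simp
  then have *: "{v, par v} \<in> edges G \<and> Suc (depth (par v)) = depth v"
    unfolding par_def by (rule someI)
  then show "{v, par v} \<in> edges G" "Suc (depth (par v)) = depth v" by auto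
  then show "par v \<in> verts G" using edge_verts by blast
qed

lemma par_in_D: "v \<in> verts G \<Longrightarrow> depth v = 1 \<Longrightarrow> par v \<in> D"
  using par[of v] depth_eq_0_iff[of "par v"] by simp

lemma branch_root: "depth v = 1 \<Longrightarrow> branch v = v"
  by (simp add: branch_def)

lemma branch_par:
  assumes "v \<in> verts G" "1 < depth v"
  shows "branch (par v) = branch v"
proof -
  obtain n where "depth v = Suc (Suc n)" using assms(2) by (metis less_natE plus_1_eq_Suc add.commute)
  then show ?thesis
    using par(2)[of v] assms by (simp add: branch_def funpow_swap1)
qed

lemma branch_in:
  "v \<in> verts G \<Longrightarrow> 0 < depth v \<Longrightarrow> branch v \<in> verts G \<and> depth (branch v) = 1"
proof (induction "depth v" arbitrary: v)
  case (Suc n)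
  show ?case
  proof (cases "n = 0")
    case True
    then show ?thesis using Suc branch_root by simp
  next
    case False
    then have "branch (par v) = branch v" "depth (par v) = n"
      using branch_par[of v] par(2)[of v] Suc by auto
    then show ?thesis using Suc.hyps(1)[of "par v"] par(3)[of v] Suc False by simp
  qed
qed simp

lemma nbhd_eq: "nbhd G D = {v \<in> verts G. depth v = 1}"
  using dist_eq_depth by (auto simp: step_nbhd_def)

lemma dominating_superset:
  assumes "D \<subseteq> S" "nbhd G D \<subseteq> S" "S \<subseteq> verts G"
  shows "step_dominating G (k - 1) S"
proof -
  have S_le: "dist_to_set G v S \<le> enat n" if "v \<in> S" for v n
    using dist_to_set_eq_0_iff[of v G S] that assms by auto
  \<comment> \<open>Descending by \<open>par\<close> ends in N(D), one step before \<open>D\<close>.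
    At depth 0 the truncated \<open>n - 1\<close> is still 0, which suits vertices of
    \<open>D\<close>.\<close>
  have *: "v \<in> verts G \<Longrightarrow> depth v = n \<Longrightarrow> dist_to_set G v S \<le> enat (n - 1)" for v n
  proof (induction n arbitrary: v)
    case 0
    then show ?case using S_le depth_eq_0_iff assms by blast
  next
    case (Suc n)
    show ?case
    proof (cases "n = 0")
      case True
      then show ?thesis using S_le[of v 0] Suc assms nbhd_eq by auto
    next
      case False
      have "dist_to_set G (par v) S \<le> enat (n - 1)"
        using Suc par(2,3)[of v] by simp
      then show ?thesis
        using dist_to_set_step[OF par(1)[of v], of S "n - 1"] Suc False by simp
    qed
  qed
  show ?thesis
    unfolding step_dominating_def
  proof (intro conjI ballI)
    fix v assume v: "v \<in> verts G"
    then have "dist_to_set G v S \<le> enat (depth v - 1)" using * by blast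
    also have "\<dots> \<le> enat (k - 1)" using depth_le[OF v] by simp
    finally show "dist_to_set G v S \<le> enat (k - 1)" .
  qed (use assms in simp)
qed

lemma exists_labelling:
  "\<exists>I. \<forall>r s. cross r s \<longrightarrow> (\<exists>s'. cross r s' \<and> (r \<in> I) \<noteq> (s' \<in> I))"
proof (rule exists_splitting_set)
  show "finite (verts G)" by (rule finite_verts)
  show "cross s r" if "cross r s" for r s
    using that unfolding cross_def by (metis insert_commute)
  show "\<not> cross r r" for r by (simp add: cross_def)
  show "r \<in> verts G" if "cross r s" for r s
    using that branch_in edge_verts unfolding cross_def by metis
qed

end

section \<open>The coloring\<close>

text \<open>The colors from \<open>N\<close> upward are free for the new edges. The label of a
  branch is the membership of its root in \<open>I\<close>.\<close>

locale labelled_step_domination = step_domination +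
  fixes I :: "'a set" and c0 :: "'a set \<Rightarrow> nat" and N :: nat
  assumes split: "cross r s \<Longrightarrow> \<exists>s'. cross r s' \<and> (r \<in> I) \<noteq> (s' \<in> I)"
    and c0_rainbow: "rainbow_connected (induced G D) c0"
    and c0_less: "e \<in> edges (induced G D) \<Longrightarrow> c0 e < N"
begin

definition label :: "'a \<Rightarrow> bool" where
  "label v \<longleftrightarrow> branch v \<in> I"

text \<open>The ends of edges between differently labelled branches, with their ancestors; the guard
  \<open>1 < depth v\<close> keeps the closure outside \<open>D\<close>.\<close>

inductive_set K :: "'a set" where
  cross_edge: "{u, w} \<in> edges G \<Longrightarrow> 0 < depth u \<Longrightarrow> 0 < depth w \<Longrightarrow> label u \<noteq> label w \<Longrightarrow> u \<in> K"
| parent: "v \<in> K \<Longrightarrow> 1 < depth v \<Longrightarrow> par v \<in> K"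

text \<open>The roots with only one evident way into \<open>D\<close>; their parent edges turn out
  to be bridges.\<close>

definition pendant :: "'a set" where
  "pendant = {r \<in> verts G. depth r = 1 \<and> r \<notin> K \<and> (\<forall>x\<in>D. {x, r} \<in> edges G \<longrightarrow> x = par r)}"

text \<open>The numbering starts at 0, so it overlaps the other new colors; this yields a maximum
  instead of a sum in the bound.\<close>

definition idx :: "'a \<Rightarrow> nat" where
  "idx = (SOME g. inj_on g pendant \<and> g ` pendant = {i. i < card pendant})"

text \<open>A pairing of label and positive level: odd numbers for \<open>False\<close>, even ones
  for \<open>True\<close>. Levels up to \<open>k\<close> fill 1 to \<open>2 * k\<close>, leaving 0
  for edges within a level.\<close>

definition code :: "bool \<Rightarrow> nat \<Rightarrow> nat" where
  "code b m = (if b then 2 * m else 2 * m - 1)"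

text \<open>The new color of an edge whose lower end is \<open>u\<close> and whose upper end is \<open>v\<close>; edges between
  vertices of equal depth get the new color 0.\<close>

definition up_col :: "'a \<Rightarrow> 'a \<Rightarrow> nat" where
  "up_col u v =
    (if u \<in> D then if v \<in> pendant then idx v else code ((v \<in> I) = (u = par v)) 1
     else code (label u) (depth v))"

text \<open>Edges are unordered, so \<open>THE\<close> reads off the ends in the order given by
  depth.\<close>

definition col :: "'a set \<Rightarrow> nat" where
  "col e =
    (if e \<subseteq> D then c0 e
     else if \<exists>u v. e = {u, v} \<and> depth u < depth v
       then N + (THE i. \<exists>u v. e = {u, v} \<and> depth u < depth v \<and> i = up_col u v)
     else N)"

definition D' :: "'a set" where
  "D' = D \<union> {v \<in> verts G. depth v = 1} \<union> K"

abbreviation H :: "'a ugraph" where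
  "H \<equiv> induced G D'"

section \<open>Properties of the codes, of \<open>K\<close> and of \<open>D'\<close>\<close>

lemma code_inject: "0 < m \<Longrightarrow> 0 < n \<Longrightarrow> code b m = code b' n \<longleftrightarrow> b = b' \<and> m = n"
  unfolding code_def by (cases b; cases b'; simp; presburger)

lemma code_pos: "0 < m \<Longrightarrow> 0 < code b m"
  by (simp add: code_def)

lemma code_le: "code b m \<le> 2 * m"
  by (simp add: code_def)

lemma K_in: "v \<in> K \<Longrightarrow> v \<in> verts G \<and> 0 < depth v"
proof (induction rule: K.induct)
  case (cross_edge u w)
  then show ?case using edge_verts by blast
next
  case (parent v)
  then show ?case using par(2,3)[of v] by auto
qed

lemma K_branch: "v \<in> K \<Longrightarrow> branch v \<in> K"
proof (induction "depth v" arbitrary: v)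
  case 0
  then show ?case using K_in by force
next
  case (Suc n)
  show ?case
  proof (cases "n = 0")
    case True
    then show ?thesis using Suc branch_root by simp
  next
    case False
    then have "branch (par v) = branch v" "depth (par v) = n"
      using branch_par[of v] par(2)[of v] Suc K_in by auto
    then show ?thesis using Suc.hyps(1)[of "par v"] K.parent[of v] Suc False by simp
  qed
qed

lemma D'_subset: "D' \<subseteq> verts G"
  using D_subset K_in by (auto simp: D'_def)

lemma D_D': "D \<subseteq> D'"
  by (auto simp: D'_def)

lemma H_edges: "edges H = {e \<in> edges G. e \<subseteq> D'}" and H_verts: "verts H = D'"
  by (simp_all add: induced_def)

lemma D'_notD: "v \<in> D' \<Longrightarrow> v \<notin> D \<Longrightarrow> v \<in> verts G \<and> 0 < depth v"
  using D'_subset depth_eq_0_iff by auto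

lemma par_D':
  assumes "v \<in> D'" "v \<notin> D"
  shows "par v \<in> D'"
proof (cases "depth v = 1")
  case True
  then show ?thesis using par_in_D D'_notD assms D_D' by blast
next
  case False
  then have "v \<in> K" "1 < depth v" using assms D'_notD[OF assms] by (auto simp: D'_def)
  then show ?thesis using K.parent by (auto simp: D'_def)
qed

text \<open>Without its parent edge, the branch of \<open>r\<close> is cut off: another edge to
  \<open>D\<close> would start at \<open>r\<close> and contradict uniqueness, and an edge to another
  branch would put \<open>r\<close> into \<open>K\<close>.\<close>

lemma pendant_bridge:
  assumes r: "r \<in> pendant"
  shows "{par r, r} \<in> edges_between G D (nbhd G D)" "is_bridge G {par r, r}"
proof -
  have rV: "r \<in> verts G" "depth r = 1" "r \<notin> K"
    and uniq: "\<And>x. x \<in> D \<Longrightarrow> {x, r} \<in> edges G \<Longrightarrow> x = par r"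
    using r by (auto simp: pendant_def)
  have p: "{par r, r} \<in> edges G" "par r \<in> D"
    using par(1)[of r] par_in_D[of r] rV by (auto simp: insert_commute)
  then show "{par r, r} \<in> edges_between G D (nbhd G D)"
    unfolding edges_between_def nbhd_eq using rV by blast
  define T where "T = {v \<in> verts G. 0 < depth v \<and> branch v = r}"
  have closed: "y \<in> T" if "{x, y} \<in> edges (delete_edge G {par r, r})" "x \<in> T" for x y
  proof -
    have xy: "{x, y} \<in> edges G" "{x, y} \<noteq> {par r, r}" using that by (auto simp: delete_edge_def)
    have x: "x \<in> verts G" "0 < depth x" "branch x = r" using that(2) by (auto simp: T_def)
    have y: "y \<in> verts G" using edge_verts xy by blast
    have y0: "0 < depth y"
    proof (rule ccontr)
      assume "\<not> 0 < depth y"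
      then have "y \<in> D" "depth x = 1"
        using depth_eq_0_iff[OF y] depth_edge[OF xy(1)] x by auto
      then have "x = r" "y = par r" using x branch_root uniq xy by (auto simp: insert_commute)
      then show False using xy by (simp add: insert_commute)
    qed
    have "branch y = r"
    proof (rule ccontr)
      assume "branch y \<noteq> r"
      then have "cross r (branch y)" unfolding cross_def using x xy y0 by blast
      \<comment> \<open>The branch of \<open>y\<close> may have the same label as that of
        \<open>r\<close>; \<open>split\<close> supplies a possibly different adjacent branch with
        the other label.\<close>
      then obtain s where "cross r s" "(r \<in> I) \<noteq> (s \<in> I)" using split by blast
      then obtain u w where "{u, w} \<in> edges G" "0 < depth u" "0 < depth w" "branch u = r"
        "label u \<noteq> label w"
        unfolding cross_def label_def by blast
      then show False using K.cross_edge K_branch rV(3) by blast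
    qed
    then show ?thesis using y y0 by (simp add: T_def)
  qed
  have "\<not> graph_connected (delete_edge G {par r, r})"
  proof
    assume "graph_connected (delete_edge G {par r, r})"
    moreover have "verts (delete_edge G {par r, r}) = verts G" by (simp add: delete_edge_def)
    ultimately obtain q where "path_from_to (delete_edge G {par r, r}) r q (par r)"
      unfolding graph_connected_def using rV p D_subset by blast
    then have "par r \<in> T"
      by (rule path_stays) (use rV branch_root closed in \<open>auto simp: T_def\<close>)
    then show False using p depth_D by (auto simp: T_def)
  qed
  then show "is_bridge G {par r, r}" using p conn by (simp add: is_bridge_def)
qed

lemma finite_pendant: "finite pendant"
  using finite_verts by (simp add: pendant_def)

text \<open>Each bridge has one end in \<open>D\<close> and one outside, so it determines its
  root.\<close>

lemma card_pendant_le: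
  "card pendant \<le> card {e \<in> edges_between G D (nbhd G D). is_bridge G e}"
proof (rule card_inj_on_le)
  show "inj_on (\<lambda>r. {par r, r}) pendant"
  proof (rule inj_onI)
    fix r s assume rs: "r \<in> pendant" "s \<in> pendant" "{par r, r} = {par s, s}"
    then have "par r \<in> D" "par s \<in> D" "r \<notin> D" "s \<notin> D"
      using par_in_D depth_D by (auto simp: pendant_def)
    then show "r = s" using rs(3) by (metis doubleton_eq_iff)
  qed
  show "(\<lambda>r. {par r, r}) ` pendant \<subseteq> {e \<in> edges_between G D (nbhd G D). is_bridge G e}"
    using pendant_bridge by auto
  show "finite {e \<in> edges_between G D (nbhd G D). is_bridge G e}"
    by (rule finite_subset[OF _ finite_edges]) (auto simp: edges_between_def)
qed

lemma idx: "inj_on idx pendant" "r \<in> pendant \<Longrightarrow> idx r < card pendant"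
proof -
  obtain f and n :: nat where f: "f ` pendant = {i. i < n}" "inj_on f pendant"
    using finite_imp_inj_to_nat_seg[OF finite_pendant] by blast
  then have "n = card pendant" using card_image[OF f(2)] by simp
  with f have "\<exists>g::'a \<Rightarrow> nat. inj_on g pendant \<and> g ` pendant = {i. i < card pendant}" by blast
  then have "inj_on idx pendant \<and> idx ` pendant = {i. i < card pendant}"
    unfolding idx_def by (rule someI_ex)
  then show "inj_on idx pendant" "r \<in> pendant \<Longrightarrow> idx r < card pendant" by auto
qed

section \<open>Values of the coloring and the number of new colors\<close>

lemma col_D: "e \<in> edges (induced G D) \<Longrightarrow> col e = c0 e"
  by (simp add: col_def induced_def)

lemma col_up:
  assumes "depth u < depth v"
  shows "col {u, v} = N + up_col u v"
proof -
  have uniq: "x = u \<and> y = v" if "{u, v} = {x, y}" "depth x < depth y" for x y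
    using that assms by (auto simp: doubleton_eq_iff)
  have "v \<notin> D" using depth_D assms by auto
  moreover have "(THE i. \<exists>x y. {u, v} = {x, y} \<and> depth x < depth y \<and> i = up_col x y) = up_col u v"
  proof (rule the_equality)
    show "\<exists>x y. {u, v} = {x, y} \<and> depth x < depth y \<and> up_col u v = up_col x y"
      using assms by (intro exI[of _ u] exI[of _ v]) simp
  next
    fix i assume "\<exists>x y. {u, v} = {x, y} \<and> depth x < depth y \<and> i = up_col x y"
    then obtain x y where xy: "{u, v} = {x, y}" "depth x < depth y" "i = up_col x y" by blast
    then show "i = up_col u v" using uniq[OF xy(1,2)] by simp
  qed
  ultimately show ?thesis using assms unfolding col_def by auto
qed

lemma col_level:
  assumes "depth u = depth v" "v \<notin> D"
  shows "col {u, v} = N"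
  using assms unfolding col_def by (auto simp: doubleton_eq_iff)

text \<open>A forest edge carries the label of its upper end: parent and child share a branch above
  the root, and at a root \<open>up_col\<close> gives the parent edge the root's own label. Only
  parent edges of pendant roots deviate.\<close>

lemma col_par:
  assumes "v \<in> verts G" "0 < depth v" "branch v \<notin> pendant"
  shows "col {v, par v} = N + code (label v) (depth v)"
proof -
  note p = par[OF assms(1,2)]
  have "col {par v, v} = N + up_col (par v) v" using p by (intro col_up) simp
  also have "up_col (par v) v = code (label v) (depth v)"
  proof (cases "depth v = 1")
    case True
    then show ?thesis using par_in_D branch_root assms by (simp add: up_col_def label_def)
  next
    case False
    then have "par v \<notin> D" using depth_D p by fastforce
    moreover have "branch (par v) = branch v" using branch_par False assms by simp
    ultimately show ?thesis by (simp add: up_col_def label_def)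
  qed
  finally show ?thesis by (simp add: insert_commute)
qed

lemma col_bound:
  assumes "e \<in> edges G" "k \<ge> 1"
  shows "col e \<in> c0 ` edges (induced G D) \<union> {N..<N + max (2 * k + 1) (card pendant)}"
proof (cases "e \<subseteq> D")
  case True
  then show ?thesis using assms by (auto simp: col_def induced_def)
next
  case False
  obtain u v where e: "e = {u, v}" "depth u \<le> depth v" using edge_cases assms by blast
  have v: "v \<in> verts G" "depth v \<le> k" using edge_verts assms e depth_le by blast+
  have "v \<notin> D" using False e edge_verts assms depth_eq_0_iff by (metis depth_D empty_subsetI
      insert_subset le_zero_eq)
  show ?thesis
  proof (cases "depth u = depth v")
    case True
    then show ?thesis using col_level \<open>v \<notin> D\<close> e by (simp add: less_max_iff_disj)
  next
    case False
    \<comment> \<open>Level 1 is treated separately for the edges leaving \<open>D\<close>; this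
      uses \<open>k \<ge> 1\<close>.\<close>
    have "code b 1 < 2 * k + 1" "code b (depth v) < 2 * k + 1" for b
      using code_le[of b 1] code_le[of b "depth v"] v assms(2) by auto
    then have "up_col u v < max (2 * k + 1) (card pendant)"
      using idx(2)[of v] by (auto simp: up_col_def less_max_iff_disj)
    then show ?thesis using col_up[of u v] False e by simp
  qed
qed

section \<open>Escaping to the dominating set\<close>

text \<open>The colors at the disposal of a descent from depth \<open>i\<close> in a branch labelled
  \<open>b\<close>.\<close>

definition low :: "bool \<Rightarrow> nat \<Rightarrow> nat set" where
  "low b i = {N + code b m | m. 0 < m \<and> m \<le> i}"

text \<open>With all colors at least \<open>N\<close>, an escape never clashes with a walk inside
  G[D].\<close>

definition escape :: "nat set \<Rightarrow> 'a \<Rightarrow> bool" where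
  "escape X v \<longleftrightarrow> X \<subseteq> {N..} \<and> (\<exists>x\<in>D. rainbow_walk H col X v x)"

lemma low_iff:
  assumes "0 < m"
  shows "N + code b m \<in> low b' i \<longleftrightarrow> b = b' \<and> m \<le> i"
proof -
  have "N + code b m \<in> low b' i \<longleftrightarrow> (\<exists>n. code b m = code b' n \<and> 0 < n \<and> n \<le> i)"
    by (simp add: low_def)
  also have "\<dots> \<longleftrightarrow> b = b' \<and> m \<le> i"
    using assms code_inject[OF assms] by metis
  finally show ?thesis .
qed

lemma N_notin_low: "N \<notin> low b i"
proof
  assume "N \<in> low b i"
  then obtain m where "0 < m" "code b m = 0" unfolding low_def by auto
  then show False using code_pos[of m b] by simp
qed

lemma low_mono: "i \<le> j \<Longrightarrow> low b i \<subseteq> low b j"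
  unfolding low_def by (auto intro: le_trans)

lemma low_disjoint:
  assumes "b \<noteq> b'"
  shows "low b i \<inter> low b' j = {}"
proof (rule ccontr)
  assume "low b i \<inter> low b' j \<noteq> {}"
  then obtain m n where "0 < m" "0 < n" "code b m = code b' n" unfolding low_def by auto
  then show False using code_inject assms by simp
qed

lemma escape_D: "v \<in> D \<Longrightarrow> escape {} v"
  unfolding escape_def using D_D' H_verts rainbow_walk.refl[of v H col] by auto

lemma escape_step:
  assumes "escape X w" "{v, w} \<in> edges G" "v \<in> D'" "w \<in> D'" "col {v, w} \<notin> X" "N \<le> col {v, w}"
  shows "escape (insert (col {v, w}) X) v"
proof -
  obtain x where x: "x \<in> D" "rainbow_walk H col X w x" using assms(1) unfolding escape_def by blast
  have "rainbow_walk H col (insert (col {v, w}) X) v x"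
    by (rule rainbow_walk.step) (use assms x in \<open>simp_all add: H_edges H_verts\<close>)
  then show ?thesis using assms(1,6) x(1) unfolding escape_def by auto
qed

text \<open>The two landing points are joined inside G[D] by a rainbow walk, whose colors lie below
  \<open>N\<close>.\<close>

lemma escape_join:
  assumes "escape X u" "escape Y v" "X \<inter> Y = {}"
  shows "\<exists>Z. rainbow_walk H col Z u v"
proof -
  obtain x y where x: "x \<in> D" "rainbow_walk H col X u x" and y: "y \<in> D" "rainbow_walk H col Y v y"
    using assms unfolding escape_def by blast
  obtain Z where Z: "rainbow_walk (induced G D) c0 Z x y" "Z \<subseteq> c0 ` edges (induced G D)"
    using rainbow_connected_walk[OF c0_rainbow] x y by (metis select_convs(1) induced_def)
  have ZH: "rainbow_walk H col Z x y"
    by (rule rainbow_walk_mono[OF Z(1)]) (use D_D' col_D in \<open>auto simp: induced_def\<close>)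
  have "Z \<inter> {N..} = {}" using Z(2) c0_less by fastforce
  then have "X \<inter> Z = {}" "(X \<union> Z) \<inter> Y = {}" using assms unfolding escape_def by blast+
  then show ?thesis
    using rainbow_walk_trans[OF rainbow_walk_trans[OF x(2) ZH] rainbow_walk_sym[OF y(2)]] by blast
qed

text \<open>Follow the parents: the label stays fixed and the level drops at each step, so no color
  recurs.\<close>

lemma descent:
  "v \<in> D' \<Longrightarrow> v \<notin> D \<Longrightarrow> branch v \<notin> pendant \<Longrightarrow>
    \<exists>X \<subseteq> low (label v) (depth v). escape X v"
proof (induction "depth v" arbitrary: v)
  case 0
  then show ?case using D'_notD[of v] by simp
next
  case (Suc n)
  have v: "v \<in> verts G" "0 < depth v" using D'_notD[OF Suc.prems(1,2)] by simp_all
  note p = par[OF v] and p' = par_D'[OF Suc.prems(1,2)]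
  have c: "col {v, par v} = N + code (label v) (depth v)" using col_par[OF v Suc.prems(3)] .
  have "\<exists>X \<subseteq> low (label v) n. escape X (par v)"
  proof (cases "n = 0")
    case True
    then show ?thesis using escape_D[OF par_in_D[of v]] v Suc.hyps(2) by auto
  next
    case False
    then have "branch (par v) = branch v" using branch_par v Suc.hyps(2) by simp
    moreover have "par v \<notin> D" "n = depth (par v)"
      using depth_D[of "par v"] p(2) False Suc.hyps(2) by auto
    ultimately show ?thesis
      using Suc.hyps(1)[of "par v"] Suc.prems(3) p' by (simp add: label_def)
  qed
  then obtain X where X: "X \<subseteq> low (label v) n" "escape X (par v)" by blast
  then have "col {v, par v} \<notin> X"
    using low_iff[of "depth v"] c v Suc(2) by (metis not_less_eq_eq order_refl subsetD)
  then have "escape (insert (col {v, par v}) X) v"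
    using escape_step[OF X(2) p(1) Suc.prems(1) p'] c by simp
  moreover have "insert (col {v, par v}) X \<subseteq> low (label v) (depth v)"
    using X(1) low_mono[of n "depth v"] low_iff[of "depth v"] c v Suc(2) by auto
  ultimately show ?case by blast
qed

lemma K_D': "v \<in> K \<Longrightarrow> v \<in> D' \<and> v \<notin> D \<and> branch v \<notin> pendant"
  using K_in[of v] K_branch[of v] depth_D[of v] by (auto simp: D'_def pendant_def)

text \<open>At a cross edge, step over and descend under the opposite label. From a parent, first
  climb one edge, whose level exceeds the depth of the parent.\<close>

lemma ascent:
  "v \<in> K \<Longrightarrow> \<exists>X. X \<inter> low (label v) (depth v) = {} \<and> escape X v"
proof (induction rule: K.induct)
  case (cross_edge u w)
  have K: "u \<in> K" "w \<in> K"
    using K.cross_edge[of u w] K.cross_edge[of w u] cross_edge by (auto simp: insert_commute)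
  then obtain X where X: "X \<subseteq> low (label w) (depth w)" "escape X w"
    using descent K_D' by blast
  have uw: "u \<notin> D" "w \<notin> D" using K K_D' by auto
  \<comment> \<open>The color combines the label of the lower end with the depth of the upper end:
    for the lower end the level is too high, for the upper end the label is wrong. An edge within a
    level has color \<open>N\<close>, which no positive code produces.\<close>
  have c: "N \<le> col {u, w} \<and> col {u, w} \<notin> low (label w) (depth w) \<and>
    col {u, w} \<notin> low (label u) (depth u)"
  proof (rule linorder_cases[of "depth u" "depth w"])
    assume d: "depth u < depth w"
    then have "col {u, w} = N + code (label u) (depth w)"
      using col_up uw by (simp add: up_col_def)
    then show ?thesis using low_iff[of "depth w" "label u"] d cross_edge by simp
  next
    assume "depth u = depth w"
    then show ?thesis using col_level uw N_notin_low by simp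
  next
    assume d: "depth w < depth u"
    then have "col {w, u} = N + code (label w) (depth u)"
      using col_up uw by (simp add: up_col_def)
    then show ?thesis using low_iff[of "depth u" "label w"] d cross_edge by (simp add: insert_commute)
  qed
  then have "col {u, w} \<notin> X" using X by blast
  then have "escape (insert (col {u, w}) X) u"
    using escape_step[OF X(2) cross_edge(1)] K K_D' c by blast
  moreover have "insert (col {u, w}) X \<inter> low (label u) (depth u) = {}"
    using c X low_disjoint[OF cross_edge(4)] by blast
  ultimately show ?case by blast
next
  case (parent v)
  then obtain X where X: "X \<inter> low (label v) (depth v) = {}" "escape X v" by blast
  have v: "v \<in> verts G" "0 < depth v" "branch v \<notin> pendant" "v \<in> D'"
    using K_in K_D' parent by auto
  note p = par[OF v(1,2)]
  have p': "par v \<in> D'" using K.parent K_D' parent by blast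
  have c: "col {par v, v} = N + code (label v) (depth v)"
    using col_par[OF v(1,2,3)] by (simp add: insert_commute)
  have l: "label (par v) = label v" using branch_par v parent by (simp add: label_def)
  \<comment> \<open>The induction hypothesis keeps \<open>X\<close> away from this set, so the
    climbing edge is fresh; one level lower, its color is outside the set to be avoided.\<close>
  have "col {par v, v} \<in> low (label v) (depth v)"
    using c low_iff[of "depth v" "label v"] v by simp
  then have "col {par v, v} \<notin> X" using X(1) by blast
  then have "escape (insert (col {par v, v}) X) (par v)"
    using escape_step[OF X(2) _ p' v(4)] c p(1) by (simp add: insert_commute)
  moreover have "col {par v, v} \<notin> low (label v) (depth (par v))"
    using c low_iff[of "depth v" "label v"] v p(2) by simp
  then have "insert (col {par v, v}) X \<inter> low (label (par v)) (depth (par v)) = {}"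
    using X(1) l low_mono[of "depth (par v)" "depth v" "label v"] p(2) by auto
  ultimately show ?case by blast
qed

text \<open>Excluding \<open>v\<close> itself is enough: if \<open>v\<close> is in \<open>K\<close>,
  so is the root of its branch, which is then not pendant; otherwise \<open>v\<close> is a
  root.\<close>

lemma low_escape:
  assumes "v \<in> D'" "v \<notin> D" "v \<notin> pendant"
  shows "\<exists>X \<subseteq> low (label v) (depth v). escape X v"
proof -
  have "branch v \<notin> pendant"
    using branch_root[of v] K_D'[of v] assms by (cases "v \<in> K") (auto simp: D'_def)
  then show ?thesis using descent assms by blast
qed

text \<open>Outside \<open>K\<close> only roots remain, and one that is not pendant has a second
  neighbor in \<open>D\<close>.\<close>

lemma high_escape:
  assumes "v \<in> D'" "v \<notin> D" "v \<notin> pendant"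
  shows "\<exists>X. X \<inter> low (label v) (depth v) = {} \<and> escape X v"
proof (cases "v \<in> K")
  case True
  then show ?thesis by (rule ascent)
next
  case False
  then have root: "depth v = 1" "v \<in> verts G" using assms by (auto simp: D'_def)
  then obtain x where x: "x \<in> D" "{x, v} \<in> edges G" "x \<noteq> par v"
    using assms False by (auto simp: pendant_def)
  have vx: "{v, x} \<in> edges G" using x(2) by (simp add: insert_commute)
  \<comment> \<open>Here the test \<open>u = par v\<close> in \<open>up_col\<close> fails, which
    flips the label.\<close>
  have "col {x, v} = N + code (\<not> label v) 1"
    using col_up[of x v] depth_D[OF x(1)] x root assms branch_root
    by (simp add: up_col_def label_def)
  then have c: "col {v, x} = N + code (\<not> label v) 1" by (simp add: insert_commute)
  then have "escape {col {v, x}} v"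
    using escape_step[OF escape_D[OF x(1)] vx assms(1)] x(1) D_D' by auto
  moreover have "col {v, x} \<notin> low (label v) (depth v)" using c low_iff[of 1] by simp
  ultimately show ?thesis by blast
qed

lemma pendant_escape:
  assumes "r \<in> pendant"
  shows "escape {N + idx r} r"
proof -
  have r: "r \<in> verts G" "depth r = 1" "r \<in> D'"
    using assms by (simp_all add: pendant_def D'_def)
  have p: "par r \<in> D" "{r, par r} \<in> edges G" using par_in_D[OF r(1,2)] par(1)[OF r(1)] r(2) by simp_all
  have "col {par r, r} = N + idx r"
    using col_up[of "par r" r] depth_D p r assms by (simp add: up_col_def)
  then have "col {r, par r} = N + idx r" by (simp add: insert_commute)
  then show ?thesis
    using escape_step[OF escape_D[OF p(1)] p(2)] r p D_D' by auto
qed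

text \<open>The single color of the pendant edge can spoil at most one of two escapes with disjoint
  color sets.\<close>

lemma disjoint_escapes_pendant:
  assumes "u \<in> pendant" "v \<notin> pendant" "v \<in> D'" "v \<notin> D"
  shows "\<exists>X Y. escape X u \<and> escape Y v \<and> X \<inter> Y = {}"
proof -
  obtain X where X: "X \<subseteq> low (label v) (depth v)" "escape X v"
    using low_escape[OF assms(3,4,2)] by blast
  obtain Y where Y: "Y \<inter> low (label v) (depth v) = {}" "escape Y v"
    using high_escape[OF assms(3,4,2)] by blast
  have "{N + idx u} \<inter> X = {} \<or> {N + idx u} \<inter> Y = {}" using X(1) Y(1) by blast
  then show ?thesis using pendant_escape[OF assms(1)] X(2) Y(2) by blast
qed

text \<open>The vertex of smaller depth descends; the other one takes the escape avoiding all colors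
  of its own, larger, \<open>low\<close> set.\<close>

lemma disjoint_escapes_le:
  assumes "u \<in> D'" "u \<notin> D" "u \<notin> pendant" "v \<in> D'" "v \<notin> D" "v \<notin> pendant"
    and "label u = label v" "depth u \<le> depth v"
  shows "\<exists>X Y. escape X u \<and> escape Y v \<and> X \<inter> Y = {}"
proof -
  obtain X where X: "X \<subseteq> low (label u) (depth u)" "escape X u"
    using low_escape[OF assms(1-3)] by blast
  obtain Y where Y: "Y \<inter> low (label v) (depth v) = {}" "escape Y v"
    using high_escape[OF assms(4-6)] by blast
  have "X \<inter> Y = {}"
    using X(1) Y(1) low_mono[OF assms(8), of "label u"] assms(7) by auto
  then show ?thesis using X Y by blast
qed

lemma disjoint_escapes:
  assumes "u \<in> D'" "v \<in> D'" "u \<notin> D" "v \<notin> D" "u \<noteq> v"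
  shows "\<exists>X Y. escape X u \<and> escape Y v \<and> X \<inter> Y = {}"
proof -
  consider "u \<in> pendant" "v \<in> pendant" | "u \<in> pendant" "v \<notin> pendant"
    | "u \<notin> pendant" "v \<in> pendant" | "u \<notin> pendant" "v \<notin> pendant" by blast
  then show ?thesis
  proof cases
    case 1
    then have "{N + idx u} \<inter> {N + idx v} = {}" using idx(1) assms(5) by (auto dest: inj_onD)
    then show ?thesis using pendant_escape 1 by blast
  next
    case 2
    then show ?thesis using disjoint_escapes_pendant assms by blast
  next
    case 3
    then show ?thesis using disjoint_escapes_pendant[of v u] assms by blast
  next
    case 4
    show ?thesis
    proof (cases "label u = label v")
      case True
      then show ?thesis
        using disjoint_escapes_le[of u v] disjoint_escapes_le[of v u] 4 assms
        by (cases "depth u \<le> depth v") (auto simp: Int_commute)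
    next
      case False
      obtain X where X: "X \<subseteq> low (label u) (depth u)" "escape X u"
        using low_escape[OF assms(1,3) 4(1)] by blast
      obtain Y where Y: "Y \<subseteq> low (label v) (depth v)" "escape Y v"
        using low_escape[OF assms(2,4) 4(2)] by blast
      \<comment> \<open>With different labels both vertices simply descend.\<close>
      show ?thesis using X Y low_disjoint[OF False] by blast
    qed
  qed
qed

section \<open>Rainbow connection of \<open>H\<close> and the color count\<close>

lemma H_rainbow: "rainbow_connected H col"
proof (rule rainbow_connectedI)
  fix u v assume "u \<in> verts H" "v \<in> verts H"
  then have uv: "u \<in> D'" "v \<in> D'" by (simp_all add: H_verts)
  have some_escape: "\<exists>X. escape X w" if "w \<in> D'" for w
    using that escape_D pendant_escape low_escape by blast
  consider "u \<in> D" | "v \<in> D" | "u = v" | "u \<notin> D" "v \<notin> D" "u \<noteq> v" by blast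
  then show "\<exists>X. rainbow_walk H col X u v"
  proof cases
    case 3
    then show ?thesis using uv H_verts by (metis rainbow_walk.refl)
  next
    case 4
    then show ?thesis using disjoint_escapes escape_join uv by metis
  \<comment> \<open>A vertex of \<open>D\<close> escapes with no colors at all, so any escape of the
    other vertex is disjoint from it.\<close>
  qed (use some_escape uv escape_D escape_join in \<open>metis inf_bot_left inf_bot_right\<close>)+
qed

lemma H_dominating: "connected_step_dominating G (k - 1) D'"
  unfolding connected_step_dominating_def
proof (rule conjI)
  have "nbhd G D \<subseteq> D'" unfolding nbhd_eq D'_def by blast
  then show "step_dominating G (k - 1) D'"
    using dominating_superset D_D' D'_subset by simp
  have "verts H \<noteq> {}" unfolding H_verts using D_nonempty D_D' by blast
  \<comment> \<open>Connectedness is read off from the rainbow coloring.\<close>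
  then show "graph_connected H" by (rule rainbow_connected_imp_connected[OF H_rainbow])
qed

lemma H_rc_le:
  assumes "k \<ge> 1"
  shows "rc H \<le> card (c0 ` edges (induced G D)) + max (2 * k + 1) (card pendant)"
proof -
  have fin: "finite (edges (induced G D))" using finite_edges by (simp add: induced_def)
  have "rc H \<le> card (col ` edges H)" using rc_le H_rainbow by blast
  also have "\<dots> \<le> card (c0 ` edges (induced G D) \<union> {N..<N + max (2 * k + 1) (card pendant)})"
  proof (rule card_mono)
    show "finite (c0 ` edges (induced G D) \<union> {N..<N + max (2 * k + 1) (card pendant)})"
      using fin by simp
    show "col ` edges H \<subseteq> c0 ` edges (induced G D) \<union> {N..<N + max (2 * k + 1) (card pendant)}"
      unfolding H_edges using col_bound assms by blast
  qed
  also have "\<dots> \<le> card (c0 ` edges (induced G D)) + max (2 * k + 1) (card pendant)"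
    using card_Un_le[of "c0 ` edges (induced G D)" "{N..<N + max (2 * k + 1) (card pendant)}"] by simp
  finally show ?thesis .
qed

end

theorem theorem1:
  fixes G :: "'a ugraph" and D :: "'a set" and k :: nat
  assumes "simple_graph G"
    and "graph_connected G"
    and "k \<ge> 1"
    and "connected_step_dominating G k D"
  shows "\<exists>D'. D \<subseteq> D' \<and> connected_step_dominating G (k - 1) D' \<and>
           rc (induced G D') \<le> rc (induced G D) +
             max (2 * k + 1) (card {e \<in> edges_between G D (nbhd G D). is_bridge G e})"
proof -
  interpret step_domination G D k using assms by unfold_locales
  obtain I where I: "\<forall>r s. cross r s \<longrightarrow> (\<exists>s'. cross r s' \<and> (r \<in> I) \<noteq> (s' \<in> I))"
    using exists_labelling by blast
  have fin: "finite (edges (induced G D))" using finite_edges by (simp add: induced_def)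
  obtain c0 where c0: "rainbow_connected (induced G D) c0"
    "card (c0 ` edges (induced G D)) = rc (induced G D)"
    using rc_attained[OF D_connected fin] by blast
  have "finite (c0 ` edges (induced G D))" using fin by simp
  then obtain N where N: "\<forall>i \<in> c0 ` edges (induced G D). i < N"
    unfolding finite_nat_set_iff_bounded by blast
  interpret labelled_step_domination G D k I c0 N
  proof
    show "\<exists>s'. cross r s' \<and> (r \<in> I) \<noteq> (s' \<in> I)" if "cross r s" for r s
      using I that by blast
  qed (use c0(1) N in simp_all)
  have "rc H \<le> rc (induced G D) +
      max (2 * k + 1) (card {e \<in> edges_between G D (nbhd G D). is_bridge G e})"
    using H_rc_le[OF assms(3)] c0 card_pendant_le by simp
  then show ?thesis using D_D' H_dominating by blast
qed

end
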